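(* Consider the system $$\rho_{i+1}-\rho_{\rm c}=\rho_i-\rho_{\rm c}+\frac{q^2}{2\lambda_i}-q\sin\theta_i,\qquad \sin\theta_i=\sin\Big(\zeta_i-\varphi_i\mp\big(\tfrac{\pi}{2}-\alpha_i-\tfrac{\phi_i}{2}\big)\Big),$$ with $\lambda_i=\rho_i+\frac1\kappa$, controlled by the approximation method described in the context. Suppose the gain $K_i$ equals a constant $K$ for all $i$, with $|1-K|<1$. Suppose the leg placement angle $\alpha_i$ is determined by solving $$\sin\Big(\zeta_i-\varphi_i\mp\big(\tfrac{\pi}{2}-\alpha_i-\tfrac{\phi_i}{2}\big)\Big)=\sin\tilde\theta_i+\frac{\tilde K_i}{q}\,(\rho_i-\rho_{\rm c}-\tilde\rho_i),$$ where for every $i$ $$\tilde K_i=\frac{\tilde M_i\,q}{\rho_i-\rho_{\rm c}-\tilde\rho_i},\qquad \tilde M_i=\min_{\alpha_i\in[\alpha_{\min},\alpha_{\max}]}|\sin\theta_i-\sin\tilde\theta_i|.$$ Let $\tilde M=\sup_i\tilde M_i$. Then $$\limsup_{i\to\infty}|\rho_i-\rho_{\rm c}|\le\frac{\tilde M q}{1-|1-K|}.$$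
   Context: Stances $i=1,2,\dots$ alternate between right and left; in $\mp$ the upper sign is for right stances and the lower sign for left stances. $q>0$ is the constant step size, $\kappa$ the constant curvature of the desired path (a circle, or a straight line with $\kappa=0$, in which case $q^2/(2\lambda_i)$ is read as $0$), $\rho_i$ the distance from the center of mass to the curve, $\rho_{\rm c}$ the desired distance, $\lambda_i=\rho_i+1/\kappa>0$. $\zeta_i$ and $\varphi_i$ are the directions (angles to a fixed axis) of the tangent to the curve at the closest point and of the velocity of the center of mass, known at the start of stance $i$; $\phi_i$ is the angle swept by the leg during the stance (kept constant since $q$ and the leg length are constant). $\alpha_i$ is the leg placement angle, constrained to $[\alpha_{\min},\alpha_{\max}]\subset(0,\pi/2)$. All angles $\theta_i,\tilde\theta_i$ are taken in $(-\pi/2,\pi/2)$. Put $f_i=-K_i(\rho_i-\rho_{\rm c})$ for the gain $K_i$, chosen so that the desired steering angle $\tilde\theta_i$ exists, where $\tilde\theta_i$ is given by $$q\sin\tilde\theta_i=\frac{q^2}{2\lambda_i}-f_i .$$ Put $\tilde\rho_{i+1}=\rho_i-\rho_{\rm c}+f_i=(1-K_i)(\rho_i-\rho_{\rm c})$. (Thus $\tilde\rho_i$ is defined for $i\ge2$, and the feedback law for $\alpha_i$ is applied for those $i$.) Approximation method: at each stance, $\alpha_i\in[\alpha_{\min},\alpha_{\max}]$ is chosen to minimize $|\sin\theta_i-\sin\tilde\theta_i|$ (with $\theta_i$ regarded as a function of $\alpha_i$), so that the minimum value $\tilde M_i=\min_{\alpha_i\in[\alpha_{\min},\alpha_{\max}]}|\sin\theta_i-\sin\tilde\theta_i|$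 is attained; with $\tilde K_i=\tilde M_i\,q/(\rho_i-\rho_{\rm c}-\tilde\rho_i)$ the equation for $\alpha_i$, namely $\sin\theta_i=\sin\tilde\theta_i+\frac{\tilde K_i}{q}(\rho_i-\rho_{\rm c}-\tilde\rho_i)$ with $\sin\theta_i=\sin\big(\zeta_i-\varphi_i\mp(\tfrac{\pi}{2}-\alpha_i-\tfrac{\phi_i}{2})\big)$, reads $\sin\theta_i-\sin\tilde\theta_i=\tilde M_i$. If $\tilde M_i=0$ one takes $\tilde K_i=0$. *)

theory Defs
  imports "HOL-Analysis.Analysis"
begin

text \<open>
  The term \<open>q\<^sup>2 / (2 \<lambda>)\<close> for a path of constant curvature \<open>\<kappa>\<close>; it is read as \<open>0\<close> on a straight line,
  where \<open>\<lambda> = \<rho> + 1 / \<kappa>\<close> is infinite.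
\<close>

definition curvature_term :: "real \<Rightarrow> real \<Rightarrow> real \<Rightarrow> real" where
  "curvature_term q \<kappa> lam = (if \<kappa> = 0 then 0 else q\<^sup>2 / (2 * lam))"

text \<open>
  The angle \<open>\<zeta> - \<phi> \<mp> (\<pi>/2 - \<alpha> - swept/2)\<close>: here \<open>\<phi>\<close> is the direction of the velocity and
  \<open>swept\<close> the angle swept by the leg; the upper sign belongs to right stances.
\<close>

definition steering_angle :: "bool \<Rightarrow> real \<Rightarrow> real \<Rightarrow> real \<Rightarrow> real \<Rightarrow> real" where
  "steering_angle right \<zeta> \<phi> swept \<alpha> =
     (if right then \<zeta> - \<phi> - (pi / 2 - \<alpha> - swept / 2)
               else \<zeta> - \<phi> + (pi / 2 - \<alpha> - swept / 2))"

definition steering_error :: "bool \<Rightarrow> real \<Rightarrow> real \<Rightarrow> real \<Rightarrow> real \<Rightarrow> real \<Rightarrow> real" where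
  "steering_error right \<zeta> \<phi> swept \<theta>d \<alpha> = \<bar>sin (steering_angle right \<zeta> \<phi> swept \<alpha>) - sin \<theta>d\<bar>"

definition min_steering_error ::
    "real \<Rightarrow> real \<Rightarrow> bool \<Rightarrow> real \<Rightarrow> real \<Rightarrow> real \<Rightarrow> real \<Rightarrow> real" where
  "min_steering_error \<alpha>min \<alpha>max right \<zeta> \<phi> swept \<theta>d =
     (LEAST m. m \<in> steering_error right \<zeta> \<phi> swept \<theta>d ` {\<alpha>min..\<alpha>max})"

definition feedback :: "(nat \<Rightarrow> real) \<Rightarrow> (nat \<Rightarrow> real) \<Rightarrow> real \<Rightarrow> nat \<Rightarrow> real" where
  "feedback Kg \<rho> \<rho>c i = - Kg i * (\<rho> i - \<rho>c)"

text \<open>The prediction for stance \<open>i\<close> made at stance \<open>i - 1\<close>; only meaningful for \<open>i \<ge> 2\<close>.\<close>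

definition predicted_error :: "(nat \<Rightarrow> real) \<Rightarrow> (nat \<Rightarrow> real) \<Rightarrow> real \<Rightarrow> nat \<Rightarrow> real" where
  "predicted_error Kg \<rho> \<rho>c i = \<rho> (i - 1) - \<rho>c + feedback Kg \<rho> \<rho>c (i - 1)"

lemma predicted_error_Suc:
  "predicted_error Kg \<rho> \<rho>c (Suc i) = (1 - Kg i) * (\<rho> i - \<rho>c)"
  by (simp add: predicted_error_def feedback_def algebra_simps)

text \<open>
  If \<open>M \<noteq> 0\<close> and \<open>d = 0\<close>, the gain is undefined on paper and \<open>0\<close> here. The law for the placement
  angle then asks for steering error \<open>0\<close>, which contradicts \<open>M \<noteq> 0\<close>, so this case never arises.
\<close>

definition corrective_gain :: "real \<Rightarrow> real \<Rightarrow> real \<Rightarrow> real" where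
  "corrective_gain q M d = (if M = 0 then 0 else M * q / d)"

text \<open>The minimum is attained, and lies in \<open>{0..2}\<close>, so that suprema of such minima are finite.\<close>

lemma min_steering_error_attained:
  assumes "\<alpha>min \<le> \<alpha>max"
  shows "\<exists>a\<in>{\<alpha>min..\<alpha>max}. min_steering_error \<alpha>min \<alpha>max right \<zeta> \<phi> swept \<theta>d
            = steering_error right \<zeta> \<phi> swept \<theta>d a
          \<and> (\<forall>b\<in>{\<alpha>min..\<alpha>max}. steering_error right \<zeta> \<phi> swept \<theta>d a
                \<le> steering_error right \<zeta> \<phi> swept \<theta>d b)"
proof -
  let ?f = "steering_error right \<zeta> \<phi> swept \<theta>d"
  have "continuous_on {\<alpha>min..\<alpha>max} ?f"
    unfolding steering_error_def steering_angle_def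
    by (cases right) (auto intro!: continuous_intros)
  then obtain a where a: "a \<in> {\<alpha>min..\<alpha>max}" "\<And>b. b \<in> {\<alpha>min..\<alpha>max} \<Longrightarrow> ?f a \<le> ?f b"
    using continuous_attains_inf[of "{\<alpha>min..\<alpha>max}" ?f] assms by auto
  have "min_steering_error \<alpha>min \<alpha>max right \<zeta> \<phi> swept \<theta>d = ?f a"
    unfolding min_steering_error_def by (rule Least_equality) (use a in auto)
  with a show ?thesis by blast
qed

lemma min_steering_error_bounds:
  assumes "\<alpha>min \<le> \<alpha>max"
  shows "min_steering_error \<alpha>min \<alpha>max right \<zeta> \<phi> swept \<theta>d \<in> {0..2}"
proof -
  obtain a where "min_steering_error \<alpha>min \<alpha>max right \<zeta> \<phi> swept \<theta>d
            = steering_error right \<zeta> \<phi> swept \<theta>d a"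
    using min_steering_error_attained[OF assms] by blast
  moreover have "\<bar>sin x - sin y\<bar> \<le> 2" for x y :: real
    using abs_sin_le_one[of x] abs_sin_le_one[of y] by linarith
  ultimately show ?thesis by (simp add: steering_error_def)
qed

end

theory Submission
  imports Defs
begin

text \<open>
  The law for the placement angle turns the dynamics into
  \<open>e (i + 1) = (1 - K) * e i - q * d i\<close> with \<open>e i = \<rho> i - \<rho>c\<close> and \<open>\<bar>d i\<bar> \<le> M i\<close>:
  a contraction with a bounded perturbation.
\<close>

text \<open>\<open>b / (1 - c)\<close> is the fixed point of the map taking \<open>x\<close> to
  \<open>c * x + b\<close>, which is monotone as \<open>0 \<le> c\<close>. The excess of
  \<open>e\<close> over the fixed point is therefore multiplied by at most \<open>c\<close> per step
  and is dominated by a geometric sequence tending to 0.\<close>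

lemma limsup_contraction_with_bounded_perturbation:
  fixes e :: "nat \<Rightarrow> real"
  assumes "0 \<le> c" "c < 1"
    and step: "\<And>i. i \<ge> n0 \<Longrightarrow> e (Suc i) \<le> c * e i + b"
  shows "limsup (\<lambda>i. ereal (e i)) \<le> ereal (b / (1 - c))"
proof -
  have "b + c * (b / (1 - c)) = b / (1 - c)"
    using assms by (simp add: field_simps)
  have bound: "e (n + n0) \<le> b / (1 - c) + c ^ n * (e n0 - b / (1 - c))" for n
  proof (induction n)
    case (Suc n)
    have "e (Suc n + n0) \<le> c * e (n + n0) + b"
      using step[of "n + n0"] by simp
    also have "\<dots> \<le> c * (b / (1 - c) + c ^ n * (e n0 - b / (1 - c))) + b"
      using Suc assms(1) by (intro add_right_mono mult_left_mono)
    \<comment> \<open>The grouping isolates one application of the map to its fixed point.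
      \<open>b / (1 - c)\<close> is kept as an atom, so that the fixed-point equation can rewrite
      it.\<close>
    also have "\<dots> = (b + c * (b / (1 - c))) + c ^ Suc n * (e n0 - b / (1 - c))"
      by (simp only: distrib_left power_Suc mult.assoc add_ac)
    finally show ?case
      by (simp only: \<open>b + c * (b / (1 - c)) = b / (1 - c)\<close>)
  qed simp
  have "(\<lambda>n. b / (1 - c) + c ^ n * (e n0 - b / (1 - c)))
      \<longlonglongrightarrow> b / (1 - c) + 0 * (e n0 - b / (1 - c))"
    using assms by (intro tendsto_intros LIMSEQ_realpow_zero)
  then have "limsup (\<lambda>n. ereal (b / (1 - c) + c ^ n * (e n0 - b / (1 - c)))) = ereal (b / (1 - c))"
    by (intro lim_imp_Limsup) simp_all
  moreover have "limsup (\<lambda>n. ereal (e (n + n0)))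
      \<le> limsup (\<lambda>n. ereal (b / (1 - c) + c ^ n * (e n0 - b / (1 - c))))"
    using bound by (intro Limsup_mono always_eventually) simp
  ultimately show ?thesis
    by (simp add: limsup_shift_k[of "\<lambda>i. ereal (e i)"])
qed

theorem theoremV2:
  fixes q \<kappa> \<rho>c K \<alpha>min \<alpha>max :: real
    and \<rho> lam Kg \<zeta> \<phi> swept \<alpha> \<theta> \<theta>d M Kt :: "nat \<Rightarrow> real"
    and right :: "nat \<Rightarrow> bool"
  assumes "q > 0"
    and alternate: "\<And>i. i \<ge> 1 \<Longrightarrow> right (Suc i) \<longleftrightarrow> \<not> right i"
    and swept_constant: "\<And>i. i \<ge> 1 \<Longrightarrow> swept (Suc i) = swept i"
    and lam: "\<And>i. i \<ge> 1 \<Longrightarrow> \<kappa> \<noteq> 0 \<Longrightarrow> lam i = \<rho> i + 1 / \<kappa> \<and> lam i > 0"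
    and placement_range: "0 < \<alpha>min" "\<alpha>min \<le> \<alpha>max" "\<alpha>max < pi / 2"
    and placement: "\<And>i. i \<ge> 1 \<Longrightarrow> \<alpha> i \<in> {\<alpha>min..\<alpha>max}"
    and theta_range: "\<And>i. i \<ge> 1 \<Longrightarrow> \<theta> i \<in> {- pi / 2<..<pi / 2}"
    and theta: "\<And>i. i \<ge> 1 \<Longrightarrow>
      sin (\<theta> i) = sin (steering_angle (right i) (\<zeta> i) (\<phi> i) (swept i) (\<alpha> i))"
    and dynamics: "\<And>i. i \<ge> 1 \<Longrightarrow>
      \<rho> (Suc i) - \<rho>c = \<rho> i - \<rho>c + curvature_term q \<kappa> (lam i) - q * sin (\<theta> i)"
    and gain: "\<And>i. i \<ge> 1 \<Longrightarrow> Kg i = K" and "\<bar>1 - K\<bar> < 1"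
    and desired_range: "\<And>i. i \<ge> 1 \<Longrightarrow> \<theta>d i \<in> {- pi / 2<..<pi / 2}"
    and desired: "\<And>i. i \<ge> 1 \<Longrightarrow>
      q * sin (\<theta>d i) = curvature_term q \<kappa> (lam i) - feedback Kg \<rho> \<rho>c i"
    and approximation: "\<And>i. i \<ge> 2 \<Longrightarrow>
      is_arg_min (steering_error (right i) (\<zeta> i) (\<phi> i) (swept i) (\<theta>d i))
        (\<lambda>a. a \<in> {\<alpha>min..\<alpha>max}) (\<alpha> i)"
    and M: "\<And>i. i \<ge> 2 \<Longrightarrow>
      M i = min_steering_error \<alpha>min \<alpha>max (right i) (\<zeta> i) (\<phi> i) (swept i) (\<theta>d i)"
    and Kt: "\<And>i. i \<ge> 2 \<Longrightarrow>
      Kt i = corrective_gain q (M i) (\<rho> i - \<rho>c - predicted_error Kg \<rho> \<rho>c i)"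
    and law: "\<And>i. i \<ge> 2 \<Longrightarrow>
      sin (steering_angle (right i) (\<zeta> i) (\<phi> i) (swept i) (\<alpha> i))
        = sin (\<theta>d i) + Kt i / q * (\<rho> i - \<rho>c - predicted_error Kg \<rho> \<rho>c i)"
  shows "limsup (\<lambda>i. ereal \<bar>\<rho> i - \<rho>c\<bar>) \<le> ereal ((SUP i\<in>{2..}. M i) * q / (1 - \<bar>1 - K\<bar>))"
proof -
  define S where "S = (SUP i\<in>{2..}. M i)"
  have M_bounds: "0 \<le> M i \<and> M i \<le> 2" if "i \<ge> 2" for i
    using M[OF that] min_steering_error_bounds[OF placement_range(2)] by simp
  \<comment> \<open>A real \<open>SUP\<close> is known to be an upper bound only for a set bounded
    above; the bound 2 on differences of sines provides this.\<close>
  have le_S: "M i \<le> S" if "i \<ge> 2" for i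
    unfolding S_def using M_bounds that by (intro cSUP_upper bdd_aboveI[of _ 2]) auto
  \<comment> \<open>The recursion starts at 2 because the law for the placement angle uses the
    prediction made one stance earlier.\<close>
  have "\<bar>\<rho> (Suc i) - \<rho>c\<bar> \<le> \<bar>1 - K\<bar> * \<bar>\<rho> i - \<rho>c\<bar> + S * q" if i: "i \<ge> 2" for i
  proof -
    define d where "d = sin (\<theta> i) - sin (\<theta>d i)"
    have "d = Kt i / q * (\<rho> i - \<rho>c - predicted_error Kg \<rho> \<rho>c i)"
      using law[OF i] theta[of i] i by (simp add: d_def)
    \<comment> \<open>When the prediction error is nonzero, it cancels against the denominator of
      the gain and \<open>d = M i\<close>. When it vanishes, or when \<open>M i = 0\<close>, the
      product is 0, and \<open>M i \<ge> 0\<close> suffices.\<close>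
    then have "\<bar>d\<bar> \<le> M i"
      using Kt[OF i] \<open>q > 0\<close> M_bounds[OF i] by (auto simp: corrective_gain_def)
    then have "\<bar>d\<bar> * q \<le> S * q"
      using le_S[OF i] \<open>q > 0\<close> by (intro mult_right_mono) auto
    \<comment> \<open>The desired steering angle is defined so that the curvature term cancels:
      substituting \<open>q * sin (\<theta>d i)\<close> plus the feedback for it leaves the feedback
      \<open>- K * (\<rho> i - \<rho>c)\<close> and the steering error.\<close>
    moreover have "\<rho> (Suc i) - \<rho>c = (1 - K) * (\<rho> i - \<rho>c) - d * q"
      using dynamics[of i] desired[of i] gain[of i] i
      by (simp add: d_def feedback_def algebra_simps)
    moreover have "\<bar>(1 - K) * (\<rho> i - \<rho>c) - d * q\<bar> \<le> \<bar>1 - K\<bar> * \<bar>\<rho> i - \<rho>c\<bar> + \<bar>d\<bar> * q"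
      using abs_triangle_ineq4[of "(1 - K) * (\<rho> i - \<rho>c)" "d * q"] \<open>q > 0\<close>
      by (simp add: abs_mult)
    ultimately show ?thesis by simp
  qed
  \<comment> \<open>The contraction lemma is used with
    \<open>e i = \<bar>\<rho> i - \<rho>c\<bar>\<close>, \<open>c = \<bar>1 - K\<bar>\<close>,
    \<open>b = S * q\<close> and \<open>n0 = 2\<close>.\<close>
  then show ?thesis
    unfolding S_def[symmetric] using \<open>\<bar>1 - K\<bar> < 1\<close>
    by (intro limsup_contraction_with_bounded_perturbation[of _ 2]) auto
qed

end
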